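(* Let $R$ be a strongly $\Delta$-clean ring and $a\in R$. If $a^2\in\Delta(R)$, then $a\in\Delta(R)$.
   Context: Rings are associative with identity, not necessarily commutative. $U(R)$ is the group of units of $R$. Define $\Delta(R)=\{x\in R \mid 1-xu\in U(R)\text{ for all }u\in U(R)\}$. A ring $R$ is strongly $\Delta$-clean if every $a\in R$ can be written $a=e+d$ with $e^2=e\in R$, $d\in\Delta(R)$ and $ed=de$. *)

theory Defs
  imports "HOL-Algebra.Ring"
begin

text \<open>Rings are those of \<^locale>\<open>ring\<close>: associative with identity, not necessarily
  commutative, zero ring included. \<^term>\<open>Units R\<close> consists of the two-sided
  multiplicative units.\<close>

definition Delta :: "('a, 'b) ring_scheme \<Rightarrow> 'a set" where
  "Delta R = {x \<in> carrier R. \<forall>u \<in> Units R. \<one>\<^bsub>R\<^esub> \<ominus>\<^bsub>R\<^esub> x \<otimes>\<^bsub>R\<^esub> u \<in> Units R}"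

definition strongly_Delta_clean :: "('a, 'b) ring_scheme \<Rightarrow> bool" where
  "strongly_Delta_clean R \<longleftrightarrow>
    (\<forall>a \<in> carrier R. \<exists>e \<in> carrier R. \<exists>d \<in> Delta R.
      e [^]\<^bsub>R\<^esub> (2::nat) = e \<and> a = e \<oplus>\<^bsub>R\<^esub> d \<and> e \<otimes>\<^bsub>R\<^esub> d = d \<otimes>\<^bsub>R\<^esub> e)"

end

theory Submission
  imports Defs
begin

text \<open>Write \<open>a = e + d\<close> with \<open>e\<close> idempotent, \<open>d\<close> in \<open>\<Delta>(R)\<close> and \<open>e d = d e\<close>. Then
  \<open>a - a\<^sup>2 = (1 - 2 e - d) d\<close>. Here \<open>1 - 2 e\<close> is an involution, and a unit minus an element of
  \<open>\<Delta>(R)\<close> is a unit. Since \<open>\<Delta>(R)\<close> is closed under addition and under multiplication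
  by units, \<open>a - a\<^sup>2\<close> and hence \<open>a\<close> lie in \<open>\<Delta>(R)\<close>.\<close>

context ring
begin

lemma Delta_closed: "x \<in> Delta R \<Longrightarrow> x \<in> carrier R"
  by (simp add: Delta_def)

lemma DeltaD: "x \<in> Delta R \<Longrightarrow> u \<in> Units R \<Longrightarrow> \<one> \<ominus> x \<otimes> u \<in> Units R"
  by (simp add: Delta_def)

text \<open>Factoring \<open>u\<close> out on the right leaves
  \<open>\<one> \<ominus> x \<otimes> inv u\<close>, a unit by the definition of
  \<open>Delta\<close> applied to \<open>inv u\<close>.\<close>

lemma Units_minus_Delta:
  assumes x: "x \<in> Delta R" and u: "u \<in> Units R"
  shows "u \<ominus> x \<in> Units R"
proof -
  note [simp] = Delta_closed[OF x] Units_closed[OF u] u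
  have "u \<ominus> x = (\<one> \<ominus> x \<otimes> inv u) \<otimes> u"
    by (simp add: minus_eq l_distr l_minus m_assoc)
  then show ?thesis
    using DeltaD[OF x Units_inv_Units[OF u]] u by simp
qed

lemma Delta_mult_Units:
  assumes x: "x \<in> Delta R" and u: "u \<in> Units R"
  shows "x \<otimes> u \<in> Delta R"
  using assms by (simp add: Delta_def m_assoc Units_closed)

text \<open>\<open>Delta\<close> only tests units on the right, so \<open>v\<close> is moved across
  by conjugation: 1 - v x u is the conjugate by \<open>v\<close> of 1 - x (u v), and u v is again a
  unit.\<close>

lemma Units_mult_Delta:
  assumes x: "x \<in> Delta R" and v: "v \<in> Units R"
  shows "v \<otimes> x \<in> Delta R"
proof -
  note [simp] = Delta_closed[OF x] Units_closed[OF v] v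
  have "\<one> \<ominus> v \<otimes> x \<otimes> u \<in> Units R" if u: "u \<in> Units R" for u
  proof -
    note [simp] = Units_closed[OF u]
    have "\<one> \<ominus> v \<otimes> x \<otimes> u = v \<otimes> (\<one> \<ominus> x \<otimes> (u \<otimes> v)) \<otimes> inv v"
      by (simp add: minus_eq l_distr r_distr l_minus r_minus m_assoc)
    then show ?thesis
      using DeltaD[OF x Units_m_closed[OF u v]] v by simp
  qed
  then show ?thesis by (simp add: Delta_def)
qed

text \<open>The summands are subtracted one at a time: 1 - x u is a unit, and taking away y u,
  itself in \<open>Delta R\<close>, keeps it a unit.\<close>

lemma Delta_add:
  assumes x: "x \<in> Delta R" and y: "y \<in> Delta R"
  shows "x \<oplus> y \<in> Delta R"
proof -
  note [simp] = Delta_closed[OF x] Delta_closed[OF y]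
  have "\<one> \<ominus> (x \<oplus> y) \<otimes> u \<in> Units R" if u: "u \<in> Units R" for u
  proof -
    note [simp] = Units_closed[OF u]
    have "\<one> \<ominus> (x \<oplus> y) \<otimes> u = (\<one> \<ominus> x \<otimes> u) \<ominus> y \<otimes> u"
      by (simp add: minus_eq l_distr minus_add a_assoc)
    then show ?thesis
      using Units_minus_Delta[OF Delta_mult_Units[OF y u] DeltaD[OF x u]] by simp
  qed
  then show ?thesis by (simp add: Delta_def)
qed

text \<open>The square is 1 - 4 e + 4 e e, which collapses since e e = e. The element 2 e is spelled
  \<open>e \<oplus> e\<close>.\<close>

lemma idempotent_involution:
  assumes [simp]: "e \<in> carrier R" and idem: "e \<otimes> e = e"
  shows "(\<one> \<ominus> (e \<oplus> e)) \<otimes> (\<one> \<ominus> (e \<oplus> e)) = \<one>"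
  by (simp add: minus_eq minus_add l_distr r_distr l_minus r_minus idem a_ac r_neg r_neg1 r_neg2)

end

theorem lemma2p7:
  fixes R :: "('a, 'b) ring_scheme" and a :: 'a
  assumes "ring R"
    and "strongly_Delta_clean R"
    and "a \<in> carrier R"
    and "a [^]\<^bsub>R\<^esub> (2::nat) \<in> Delta R"
  shows "a \<in> Delta R"
proof -
  interpret ring R by fact
  obtain e d where e [simp]: "e \<in> carrier R" and d: "d \<in> Delta R"
    and idem: "e [^]\<^bsub>R\<^esub> (2::nat) = e" and a: "a = e \<oplus>\<^bsub>R\<^esub> d"
    and comm: "e \<otimes>\<^bsub>R\<^esub> d = d \<otimes>\<^bsub>R\<^esub> e"
    using assms(2,3) unfolding strongly_Delta_clean_def by blast
  note [simp] = Delta_closed[OF d]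
  have ee: "e \<otimes>\<^bsub>R\<^esub> e = e"
    using idem by (simp add: numeral_2_eq_2)
  let ?v = "\<one>\<^bsub>R\<^esub> \<ominus>\<^bsub>R\<^esub> (e \<oplus>\<^bsub>R\<^esub> e)"
  \<comment> \<open>\<open>?v\<close> is its own two-sided inverse.\<close>
  have "?v \<in> Units R"
    using idempotent_involution[OF e ee] by (auto simp: Units_def)
  then have "(?v \<ominus>\<^bsub>R\<^esub> d) \<otimes>\<^bsub>R\<^esub> d \<in> Delta R"
    using d by (simp add: Units_minus_Delta Units_mult_Delta)
  \<comment> \<open>As \<open>e\<close> and \<open>d\<close> commute, the square of \<open>a\<close>
    is e + 2 e d + d d; the product adds d - 2 e d - d d, leaving e + d.\<close>
  moreover have "a = a [^]\<^bsub>R\<^esub> (2::nat) \<oplus>\<^bsub>R\<^esub> (?v \<ominus>\<^bsub>R\<^esub> d) \<otimes>\<^bsub>R\<^esub> d"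
    by (simp add: a numeral_2_eq_2 minus_eq minus_add l_distr r_distr l_minus ee comm a_ac
        r_neg r_neg1 r_neg2)
  ultimately show ?thesis
    using Delta_add[OF assms(4)] by metis
qed

end
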